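(* There is a randomized online algorithm (a modification of the Single-or-Sample algorithm) such that, for every OnlineMMS instance with $n$ agents having submodular valuations, each individual agent $i\in[n]$ receives a bundle $A_i$ with $v_i(A_i)\ge\frac1{24}\mathrm{MMS}_i$ with probability at least $1-o(1)$, where the $o(1)$ term tends to $0$ as $n\to\infty$ and depends only on $n$.
   Context: OnlineMMS problem: there are $m$ indivisible goods $[m]$ and $n$ agents; agent $i$ has a monotone valuation $v_i:2^{[m]}\to\mathbb{R}_+$. Agent $i$ arrives at time $i$; her valuation is then revealed and the algorithm must irrevocably allocate to her a subset $A_i$ of the goods not yet allocated. The algorithm knows $n$ and $[m]$ but nothing about future valuations; valuations are fixed by an oblivious adversary that may know the algorithm but not its coin tosses. $\mathrm{MMS}_i=\max_{(P_1,\dots,P_n)}\min_\ell v_i(P_\ell)$ over partitions of $[m]$ into $n$ bundles. *)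

theory Defs
  imports "HOL-Probability.Probability"
begin

text \<open>
  Goods are the numbers in \<^term>\<open>{1..m}\<close>, agents the numbers in \<^term>\<open>{1..n}\<close>. A valuation is a total
  function on \<^typ>\<open>nat set\<close>; only its values on subsets of \<^term>\<open>{1..m}\<close> carry meaning.
\<close>

type_synonym valuation = "nat set \<Rightarrow> real"

definition submodular_on :: "nat set \<Rightarrow> valuation \<Rightarrow> bool" where
  "submodular_on G v \<longleftrightarrow>
     (\<forall>S T. S \<subseteq> G \<longrightarrow> T \<subseteq> G \<longrightarrow> v (S \<union> T) + v (S \<inter> T) \<le> v S + v T)"

text \<open>No normalisation \<open>v {} = 0\<close> is imposed.\<close>

definition submodular_instance :: "nat \<Rightarrow> nat \<Rightarrow> (nat \<Rightarrow> valuation) \<Rightarrow> bool" where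
  "submodular_instance n m v \<longleftrightarrow>
     (\<forall>i\<in>{1..n}. (\<forall>S\<subseteq>{1..m}. 0 \<le> v i S) \<and> mono_on (Pow {1..m}) (v i) \<and>
                 submodular_on {1..m} (v i))"

text \<open>Bundles of a partition may be empty; in particular \<open>m < n\<close> is allowed.\<close>

definition bundle_partitions :: "nat \<Rightarrow> nat \<Rightarrow> (nat \<Rightarrow> nat set) set" where
  "bundle_partitions n m =
     {P \<in> {1..n} \<rightarrow>\<^sub>E Pow {1..m}. disjoint_family_on P {1..n} \<and> (\<Union>l\<in>{1..n}. P l) = {1..m}}"

definition MMS :: "nat \<Rightarrow> nat \<Rightarrow> valuation \<Rightarrow> real" where
  "MMS n m v = Max ((\<lambda>P. Min ((\<lambda>l. v (P l)) ` {1..n})) ` bundle_partitions n m)"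

text \<open>
  A transcript has one entry per agent served so far, in order of arrival: her valuation, her bundle,
  and a number in which the algorithm may store private coin tosses (or other internal state) for
  later use. A randomized algorithm maps \<open>n\<close>, \<open>m\<close>, the transcript and the valuation just revealed to
  a distribution over the arriving agent's bundle and the number to be stored. Discrete
  distributions are enough for full generality: there are only finitely many bundles, and the whole
  past is available, so randomness can be drawn afresh conditionally on it.
\<close>

type_synonym transcript = "(valuation \<times> nat set \<times> nat) list"

type_synonym randomized_algorithm =
  "nat \<Rightarrow> nat \<Rightarrow> transcript \<Rightarrow> valuation \<Rightarrow> (nat set \<times> nat) pmf"

definition allocated :: "transcript \<Rightarrow> nat set" where
  "allocated h = (\<Union>(u, B, c)\<in>set h. B)"

definition online_algorithm :: "randomized_algorithm \<Rightarrow> bool" where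
  "online_algorithm alg \<longleftrightarrow>
     (\<forall>n m h u. \<forall>(A, c)\<in>set_pmf (alg n m h u). A \<subseteq> {1..m} - allocated h)"

text \<open>
  The instance \<open>v\<close> is a fixed parameter of the run, independent of the coin tosses (oblivious
  adversary), and agent \<open>Suc t\<close> is served knowing only \<open>v 1, \<dots>, v (Suc t)\<close>.
\<close>

primrec run ::
  "randomized_algorithm \<Rightarrow> nat \<Rightarrow> nat \<Rightarrow> (nat \<Rightarrow> valuation) \<Rightarrow> nat \<Rightarrow> transcript pmf" where
  "run alg n m v 0 = return_pmf []"
| "run alg n m v (Suc t) =
     bind_pmf (run alg n m v t)
       (\<lambda>h. map_pmf (\<lambda>(A, c). h @ [(v (Suc t), A, c)]) (alg n m h (v (Suc t))))"

definition bundle_of :: "transcript \<Rightarrow> nat \<Rightarrow> nat set" where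
  "bundle_of h i = fst (snd (h ! (i - 1)))"

end

theory Submission
  imports Defs "HOL-Real_Asymp.Real_Asymp"
begin

text \<open>
  An agent skips with a small probability; otherwise she takes one remaining good worth
  \<open>MMS / 24\<close> if there is any, and else adds uniformly random remaining goods until their value
  reaches \<open>MMS / 24\<close>. Let \<open>u\<close> be \<open>n\<close> minus the number of agents who took a single good. An agent for
  whom the random additions have total marginal value at least \<open>MMS * u / 3\<close> at every step needs so
  few of them that she takes each good with probability at most \<open>1 / (4 * u)\<close>. To see that a later
  agent still finds enough, fix an MMS partition of hers. The total value \<open>V\<close> of what remains of its
  bundles, truncated suitably, loses at most \<open>1/2\<close> per single good and in expectation at most
  \<open>V / (4 * u)\<close> per sample. Second moments show that \<open>V\<close> stays close to this prediction, and the
  slack is of the order of \<open>u\<close>, which the skips keep large.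
\<close>

section \<open>Submodular functions\<close>

lemma submodular_onD:
  assumes "submodular_on G v" "S \<subseteq> G" "T \<subseteq> G"
  shows "v (S \<union> T) + v (S \<inter> T) \<le> v S + v T"
  using assms unfolding submodular_on_def by blast

text \<open>Adding the goods of \<open>S\<close> one by one, each gains at least what its removal
  from the full \<open>S\<close> costs, and the gains telescope. Hence removing a uniformly random
  good of \<open>S\<close> costs at most \<open>v S / card S\<close> on average.\<close>

lemma sum_removal_le:
  assumes sub: "submodular_on G v" and S: "S \<subseteq> G" "finite S" and "0 \<le> v {}"
  shows "(\<Sum>g\<in>S. v S - v (S - {g})) \<le> v S"
proof -
  have "(\<Sum>g\<in>T. v S - v (S - {g})) \<le> v T - v {}" if "T \<subseteq> S" for T
    using finite_subset[OF that S(2)] that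
  proof (induction T rule: finite_induct)
    case (insert g T)
    have eq: "insert g T \<union> (S - {g}) = S" "insert g T \<inter> (S - {g}) = T"
      using insert by auto
    have "v (insert g T \<union> (S - {g})) + v (insert g T \<inter> (S - {g})) \<le> v (insert g T) + v (S - {g})"
      by (rule submodular_onD[OF sub]) (use insert S in auto)
    then have "v S + v T \<le> v (insert g T) + v (S - {g})"
      unfolding eq .
    then show ?case using insert by simp
  qed simp
  from this[of S] show ?thesis using assms by simp
qed

text \<open>By diminishing returns, each good of \<open>D\<close> gains on top of \<open>A\<close>
  at least as much as it gains after earlier goods of \<open>D\<close> have been added.\<close>

lemma sum_marginal_ge:
  assumes sub: "submodular_on G v" and "finite D" "A \<subseteq> G" "D \<subseteq> G"
  shows "v (A \<union> D) - v A \<le> (\<Sum>g\<in>D. v (insert g A) - v A)"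
  using assms(2-)
proof (induction D rule: finite_induct)
  case (insert g D)
  show ?case
  proof (cases "g \<in> A")
    case True
    then show ?thesis using insert by (simp add: insert_absorb)
  next
    case False
    have eq: "(A \<union> D) \<union> insert g A = A \<union> insert g D" "(A \<union> D) \<inter> insert g A = A"
      using insert False by auto
    have "v ((A \<union> D) \<union> insert g A) + v ((A \<union> D) \<inter> insert g A) \<le> v (A \<union> D) + v (insert g A)"
      by (rule submodular_onD[OF sub]) (use insert in auto)
    then show ?thesis using insert unfolding eq by simp
  qed
qed simp

lemma submodular_on_sum:
  assumes "\<And>l. l \<in> L \<Longrightarrow> submodular_on G (f l)"
  shows "submodular_on G (\<lambda>S. \<Sum>l\<in>L. f l S)"
  using assms unfolding submodular_on_def by (auto simp flip: sum.distrib intro!: sum_mono)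

text \<open>Monotonicity places the values at \<open>S\<close> and \<open>T\<close> between those at
  the intersection and the union; the inequality then survives capping whichever of the four values
  exceed \<open>c\<close>.\<close>

lemma submodular_on_cap:
  fixes c \<mu> :: real
  assumes sub: "submodular_on G v" and mono: "mono_on (Pow G) v" and "0 < \<mu>"
  shows "submodular_on G (\<lambda>S. min (v (P \<inter> S) / \<mu>) c)"
  unfolding submodular_on_def
proof (intro allI impI)
  fix S T assume ST: "S \<subseteq> G" "T \<subseteq> G"
  define S' T' where "S' = P \<inter> S" and "T' = P \<inter> T"
  have G: "S' \<subseteq> G" "T' \<subseteq> G" using ST by (auto simp: S'_def T'_def)
  have le: "v A / \<mu> \<le> v B / \<mu>" if "A \<subseteq> B" "B \<subseteq> G" for A B
    using mono_onD[OF mono, of A B] that \<open>0 < \<mu>\<close> by (auto intro: divide_right_mono)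
  have m: "v S' / \<mu> \<le> v (S' \<union> T') / \<mu>" "v T' / \<mu> \<le> v (S' \<union> T') / \<mu>"
    "v (S' \<inter> T') / \<mu> \<le> v S' / \<mu>" "v (S' \<inter> T') / \<mu> \<le> v T' / \<mu>"
    using G by (auto intro!: le)
  have "(v (S' \<union> T') + v (S' \<inter> T')) / \<mu> \<le> (v S' + v T') / \<mu>"
    using submodular_onD[OF sub G] \<open>0 < \<mu>\<close> by (auto intro: divide_right_mono)
  then have "min (v (S' \<union> T') / \<mu>) c + min (v (S' \<inter> T') / \<mu>) c
      \<le> min (v S' / \<mu>) c + min (v T' / \<mu>) c"
    using m by (simp add: add_divide_distrib min_def)
  moreover have "P \<inter> (S \<union> T) = S' \<union> T'" "P \<inter> (S \<inter> T) = S' \<inter> T'"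
    by (auto simp: S'_def T'_def)
  ultimately show "min (v (P \<inter> (S \<union> T)) / \<mu>) c + min (v (P \<inter> (S \<inter> T)) / \<mu>) c
      \<le> min (v (P \<inter> S) / \<mu>) c + min (v (P \<inter> T) / \<mu>) c"
    by (simp add: S'_def T'_def)
qed

section \<open>Expectations of finitely supported distributions\<close>

lemma expectation_mono_finite:
  fixes f g :: "'a \<Rightarrow> real"
  assumes "finite (set_pmf p)" "\<And>x. x \<in> set_pmf p \<Longrightarrow> f x \<le> g x"
  shows "measure_pmf.expectation p f \<le> measure_pmf.expectation p g"
  using assms by (intro integral_mono_AE) (auto simp: AE_measure_pmf_iff integrable_measure_pmf_finite)

lemma expectation_bind_finite:
  fixes h :: "'b \<Rightarrow> real"
  assumes "finite (set_pmf p)" "\<And>x. x \<in> set_pmf p \<Longrightarrow> finite (set_pmf (f x))"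
  shows "measure_pmf.expectation (bind_pmf p f) h =
    measure_pmf.expectation p (\<lambda>x. measure_pmf.expectation (f x) h)"
proof -
  have "measure_pmf.expectation (bind_pmf p f) h =
      (\<Sum>a\<in>set_pmf p. pmf p a *\<^sub>R measure_pmf.expectation (f a) h)"
    by (rule pmf_expectation_bind) (use assms in auto)
  also have "\<dots> = measure_pmf.expectation p (\<lambda>x. measure_pmf.expectation (f x) h)"
    using assms by (subst integral_measure_pmf[of "set_pmf p"]) auto
  finally show ?thesis .
qed

section \<open>Random greedy sampling\<close>

text \<open>The first argument of the recursion is fuel; \<^term>\<open>card R\<close> steps always suffice.\<close>

primrec greedy_sample ::
  "valuation \<Rightarrow> real \<Rightarrow> nat set \<Rightarrow> nat \<Rightarrow> nat set \<Rightarrow> nat set pmf" where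
  "greedy_sample v \<theta> R 0 A = return_pmf A"
| "greedy_sample v \<theta> R (Suc k) A =
     (if \<theta> \<le> v A \<or> R \<subseteq> A then return_pmf A
      else bind_pmf (pmf_of_set (R - A)) (\<lambda>g. greedy_sample v \<theta> R k (insert g A)))"

lemma set_greedy_sample:
  assumes "finite R" "A \<subseteq> R"
  shows "set_pmf (greedy_sample v \<theta> R k A) \<subseteq> Pow R"
  using assms
proof (induction k arbitrary: A)
  case (Suc k)
  then have "set_pmf (greedy_sample v \<theta> R k (insert g A)) \<subseteq> Pow R" if "g \<in> R - A" for g
    using that by auto
  then show ?case using Suc.prems by (auto simp: set_pmf_of_set)
qed simp

lemma finite_greedy_sample:
  assumes "finite R" "A \<subseteq> R"
  shows "finite (set_pmf (greedy_sample v \<theta> R k A))"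
  using set_greedy_sample[OF assms] by (rule finite_subset) (use assms in auto)

text \<open>Every step uses up one good, so with this much fuel sampling stops only at the threshold
  or at \<open>R\<close> itself.\<close>

lemma greedy_sample_reaches:
  assumes "finite R" "A \<subseteq> R" "card (R - A) \<le> k" "\<theta> \<le> v R"
    and "B \<in> set_pmf (greedy_sample v \<theta> R k A)"
  shows "\<theta> \<le> v B"
  using assms
proof (induction k arbitrary: A)
  case 0
  then have "A = R" by auto
  then show ?case using 0 by simp
next
  case (Suc k)
  show ?case
  proof (cases "\<theta> \<le> v A \<or> R \<subseteq> A")
    case True
    then show ?thesis using Suc.prems by (auto dest: subset_antisym)
  next
    case False
    then obtain g where g: "g \<in> R - A" "B \<in> set_pmf (greedy_sample v \<theta> R k (insert g A))"
      using Suc.prems by (auto simp: set_pmf_of_set)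
    have "R - insert g A = (R - A) - {g}" by auto
    then have "card (R - insert g A) \<le> k"
      using Suc.prems g by (simp add: card_Diff_singleton)
    then show ?thesis using Suc.IH[OF _ _ _ _ g(2)] Suc.prems g by auto
  qed
qed

text \<open>Optional stopping by induction on the fuel: the sum in the hypothesis is
  \<open>card (R - A)\<close> times the expected change of \<open>F\<close> in one step.\<close>

lemma greedy_sample_supermartingale:
  fixes F :: "nat set \<Rightarrow> real"
  assumes "finite R" "A \<subseteq> R"
    and step: "\<And>A. A \<subseteq> R \<Longrightarrow> v A < \<theta> \<Longrightarrow> (\<Sum>g\<in>R - A. F (insert g A) - F A) \<le> 0"
  shows "measure_pmf.expectation (greedy_sample v \<theta> R k A) F \<le> F A"
  using assms(1,2)
proof (induction k arbitrary: A)
  case (Suc k)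
  show ?case
  proof (cases "\<theta> \<le> v A \<or> R \<subseteq> A")
    case False
    then have ne: "R - A \<noteq> {}" "finite (R - A)" using Suc.prems by auto
    have "measure_pmf.expectation (greedy_sample v \<theta> R (Suc k) A) F =
        measure_pmf.expectation (pmf_of_set (R - A))
          (\<lambda>g. measure_pmf.expectation (greedy_sample v \<theta> R k (insert g A)) F)"
      using False ne Suc.prems unfolding greedy_sample.simps
      by (subst if_not_P, fast, subst expectation_bind_finite)
        (auto simp: finite_greedy_sample set_pmf_of_set)
    also have "\<dots> \<le> measure_pmf.expectation (pmf_of_set (R - A)) (\<lambda>g. F (insert g A))"
      using ne Suc by (intro expectation_mono_finite) (auto simp: set_pmf_of_set)
    also have "\<dots> = (\<Sum>g\<in>R - A. F (insert g A)) / card (R - A)"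
      using ne by (simp add: integral_pmf_of_set)
    also have "\<dots> \<le> F A"
      using step[of A] Suc.prems False ne
      by (simp add: sum_subtractf divide_le_eq card_gt_0_iff mult.commute)
    finally show ?thesis .
  qed simp
qed simp

text \<open>
  While the value is below \<open>\<theta>\<close>, a step raises it by \<open>w / card (R - A)\<close> on average, and it never
  exceeds \<open>2 * \<theta>\<close>. Hence \<open>(2 * \<theta> - v A) / w\<close> acts as the remaining sampling time, and the
  supermartingales below charge the loss of \<open>V\<close> against it.
\<close>

lemma
  fixes V :: "nat set \<Rightarrow> real" and w \<theta> :: real
  assumes R: "finite R" and w: "0 < w" and \<theta>: "0 \<le> \<theta>" and v: "mono_on (Pow R) v" "0 \<le> v {}"
    and drift: "\<And>A. A \<subseteq> R \<Longrightarrow> v A < \<theta> \<Longrightarrow> w \<le> (\<Sum>g\<in>R - A. v (insert g A) - v A)"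
    and small: "\<And>A g. A \<subseteq> R \<Longrightarrow> v A < \<theta> \<Longrightarrow> g \<in> R - A \<Longrightarrow> v (insert g A) \<le> 2 * \<theta>"
    and V: "submodular_on R V" "mono_on (Pow R) V" "0 \<le> V {}"
    and unit: "\<And>S g. S \<subseteq> R \<Longrightarrow> g \<in> S \<Longrightarrow> V S - V (S - {g}) \<le> 1"
  defines "q \<equiv> 2 * \<theta> / w"
  shows greedy_sample_mean: "measure_pmf.expectation (greedy_sample v \<theta> R k {})
            (\<lambda>A. V R - V (R - A)) \<le> q * V R" (is ?mean)
    and greedy_sample_second_moment: "measure_pmf.expectation (greedy_sample v \<theta> R k {})
            (\<lambda>A. (V R - V (R - A))\<^sup>2) \<le> q * V R + 2 * (q * V R)\<^sup>2" (is ?second)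
proof -
  \<comment> \<open>\<open>p\<close> is the remaining sampling time, \<open>x\<close> the loss of
    \<open>V\<close> so far and \<open>b\<close> the initial value of \<open>V\<close>.\<close>
  define p where "p A = max 0 ((2 * \<theta> - v A) / w)" for A
  define x where "x A = V R - V (R - A)" for A
  define b where "b = V R"
  have monoV: "V S \<le> V T" if "S \<subseteq> T" "T \<subseteq> R" for S T
    using mono_onD[OF V(2), of S T] that by auto
  have b0: "0 \<le> b" using monoV[of "{}" R] V(3) by (simp add: b_def)
  have p0: "0 \<le> p A" for A by (simp add: p_def)
  have x0: "0 \<le> x A" for A unfolding x_def using monoV[of "R - A" R] by auto
  have q0: "0 \<le> q" using w \<theta> by (simp add: q_def)
  have p_empty: "p {} \<le> q" using w \<theta> v(2) by (simp add: p_def q_def divide_right_mono)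
  \<comment> \<open>In one step \<open>d\<close> is the loss of \<open>V\<close> and
    \<open>e\<close> the time consumed. Summed over the possible goods, the loss is at most
    \<open>b\<close> and the time at least 1.\<close>
  have steps: "\<exists>d e. (\<forall>g\<in>R - A. 0 \<le> d g \<and> d g \<le> (1::real) \<and> 0 \<le> e g \<and> x (insert g A) = x A + d g \<and>
        p (insert g A) = p A - e g) \<and> (\<Sum>g\<in>R - A. d g) \<le> b \<and> 1 \<le> (\<Sum>g\<in>R - A. e g) \<and> p A \<le> q"
    if A: "A \<subseteq> R" "v A < \<theta>" for A
  proof (intro exI conjI ballI)
    let ?d = "\<lambda>g. V (R - A) - V (R - A - {g})" and ?e = "\<lambda>g. (v (insert g A) - v A) / w"
    have ins: "R - insert g A = R - A - {g}" for g by auto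
    have "v {} \<le> v A" using mono_onD[OF v(1), of "{}" A] A by auto
    then show "p A \<le> q"
      using w \<theta> v(2) by (simp add: p_def q_def divide_right_mono)
    have "(\<Sum>g\<in>R - A. ?d g) \<le> V (R - A)"
      by (rule sum_removal_le[OF V(1)]) (use R V in auto)
    also have "\<dots> \<le> b" unfolding b_def by (rule monoV) auto
    finally show "(\<Sum>g\<in>R - A. ?d g) \<le> b" .
    show "1 \<le> (\<Sum>g\<in>R - A. ?e g)"
      using drift[OF A] w by (simp flip: sum_divide_distrib)
    fix g assume g: "g \<in> R - A"
    show "0 \<le> ?d g" using monoV[of "R - A - {g}" "R - A"] by auto
    show "?d g \<le> 1" using unit[of "R - A" g] g by auto
    have "v A \<le> v (insert g A)" using mono_onD[OF v(1), of A "insert g A"] A g by auto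
    then show "0 \<le> ?e g" using w by simp
    show "x (insert g A) = x A + ?d g" by (simp add: x_def ins)
    \<comment> \<open>Values stay at most \<open>2 * \<theta>\<close>, so the clipping at 0 in
      \<open>p\<close> has no effect here.\<close>
    show "p (insert g A) = p A - ?e g"
      using small[OF A g] A \<theta> w by (simp add: p_def max_def field_simps)
  qed
  have "measure_pmf.expectation (greedy_sample v \<theta> R k {}) (\<lambda>A. x A + b * p A) \<le> x {} + b * p {}"
  proof (rule greedy_sample_supermartingale)
    fix A assume A: "A \<subseteq> R" "v A < \<theta>"
    from steps[OF A] obtain d e where de: "\<And>g. g \<in> R - A \<Longrightarrow> x (insert g A) = x A + d g"
      "\<And>g. g \<in> R - A \<Longrightarrow> p (insert g A) = p A - e g"
      and sums: "(\<Sum>g\<in>R - A. d g) \<le> b" "1 \<le> (\<Sum>g\<in>R - A. e g)"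
      by blast
    have "(\<Sum>g\<in>R - A. (x (insert g A) + b * p (insert g A)) - (x A + b * p A)) = (\<Sum>g\<in>R - A. d g - b * e g)"
      by (rule sum.cong) (auto simp: de algebra_simps)
    also have "\<dots> = (\<Sum>g\<in>R - A. d g) - b * (\<Sum>g\<in>R - A. e g)"
      by (simp add: sum_subtractf sum_distrib_left)
    also have "\<dots> \<le> 0"
      using sums(1) mult_left_mono[OF sums(2) b0] by simp
    finally show "(\<Sum>g\<in>R - A. (x (insert g A) + b * p (insert g A)) - (x A + b * p A)) \<le> 0" .
  qed (use R in auto)
  moreover have "measure_pmf.expectation (greedy_sample v \<theta> R k {}) x
      \<le> measure_pmf.expectation (greedy_sample v \<theta> R k {}) (\<lambda>A. x A + b * p A)"
    using R b0 p0 by (intro expectation_mono_finite finite_greedy_sample) auto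
  ultimately show ?mean
    using mult_left_mono[OF p_empty b0] by (simp add: x_def[abs_def] b_def mult.commute)
  \<comment> \<open>In the potential below, \<open>2 * b * x A * p A\<close> offsets the term
    \<open>2 * x A * d g\<close> in the growth of the square. What remains sums to at most
    \<open>b + 2 * b\<^sup>2 * q\<close>, and the clock with rate \<open>c\<close> pays for
    it.\<close>
  define c where "c = b + 2 * b\<^sup>2 * q"
  have c0: "0 \<le> c" using b0 q0 by (simp add: c_def)
  have "measure_pmf.expectation (greedy_sample v \<theta> R k {}) (\<lambda>A. (x A)\<^sup>2 + 2 * b * x A * p A + c * p A)
      \<le> (x {})\<^sup>2 + 2 * b * x {} * p {} + c * p {}"
  proof (rule greedy_sample_supermartingale)
    fix A assume A: "A \<subseteq> R" "v A < \<theta>"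
    from steps[OF A] obtain d e where de: "\<And>g. g \<in> R - A \<Longrightarrow> 0 \<le> d g" "\<And>g. g \<in> R - A \<Longrightarrow> d g \<le> 1"
      "\<And>g. g \<in> R - A \<Longrightarrow> 0 \<le> e g" "\<And>g. g \<in> R - A \<Longrightarrow> x (insert g A) = x A + d g"
      "\<And>g. g \<in> R - A \<Longrightarrow> p (insert g A) = p A - e g"
      and sums: "(\<Sum>g\<in>R - A. d g) \<le> b" "1 \<le> (\<Sum>g\<in>R - A. e g)" and pq: "p A \<le> q"
      by blast
    \<comment> \<open>These are the coefficients of \<open>d\<close> and \<open>e\<close> in the
      change of the potential, after bounding the square of \<open>d\<close> by \<open>d\<close> and
      dropping the nonpositive product of \<open>d\<close> and \<open>e\<close>.\<close>
    define a1 a2 where "a1 = 2 * x A + 1 + 2 * b * p A" and "a2 = 2 * b * x A + c"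
    have a: "0 \<le> a1" "0 \<le> a2" using x0 p0 b0 c0 by (auto simp: a1_def a2_def)
    have "(\<Sum>g\<in>R - A. ((x (insert g A))\<^sup>2 + 2 * b * x (insert g A) * p (insert g A) + c * p (insert g A)) -
        ((x A)\<^sup>2 + 2 * b * x A * p A + c * p A)) \<le> (\<Sum>g\<in>R - A. a1 * d g - a2 * e g)"
    proof (rule sum_mono)
      fix g assume g: "g \<in> R - A"
      have "(d g)\<^sup>2 \<le> d g" using de(1,2)[OF g] by (simp add: power2_eq_square mult_left_le)
      moreover have "0 \<le> b * (d g * e g)" using de(1,3)[OF g] b0 by simp
      ultimately show "((x (insert g A))\<^sup>2 + 2 * b * x (insert g A) * p (insert g A) + c * p (insert g A)) -
        ((x A)\<^sup>2 + 2 * b * x A * p A + c * p A) \<le> a1 * d g - a2 * e g"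
        unfolding de(4,5)[OF g] a1_def a2_def by (simp add: algebra_simps power2_eq_square)
    qed
    also have "\<dots> = a1 * (\<Sum>g\<in>R - A. d g) - a2 * (\<Sum>g\<in>R - A. e g)"
      by (simp add: sum_subtractf sum_distrib_left)
    also have "\<dots> \<le> a1 * b - a2"
      using mult_left_mono[OF sums(1) a(1)] mult_left_mono[OF sums(2) a(2)] by simp
    also have "\<dots> = 2 * b\<^sup>2 * (p A - q)"
      by (simp add: a1_def a2_def c_def algebra_simps power2_eq_square)
    also have "\<dots> \<le> 0" using pq by (simp add: mult_nonneg_nonpos)
    finally show "(\<Sum>g\<in>R - A. ((x (insert g A))\<^sup>2 + 2 * b * x (insert g A) * p (insert g A) + c * p (insert g A)) -
        ((x A)\<^sup>2 + 2 * b * x A * p A + c * p A)) \<le> 0" .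
  qed (use R in auto)
  moreover have "measure_pmf.expectation (greedy_sample v \<theta> R k {}) (\<lambda>A. (x A)\<^sup>2)
      \<le> measure_pmf.expectation (greedy_sample v \<theta> R k {}) (\<lambda>A. (x A)\<^sup>2 + 2 * b * x A * p A + c * p A)"
    using R b0 p0 x0 c0 by (intro expectation_mono_finite finite_greedy_sample) auto
  moreover have "c * p {} \<le> c * q" by (rule mult_left_mono[OF p_empty c0])
  moreover have "c * q = q * b + 2 * (q * b)\<^sup>2" by (simp add: c_def algebra_simps power2_eq_square)
  ultimately show ?second
    by (simp add: x_def b_def)
qed

section \<open>The algorithm\<close>

text \<open>The probability must vanish while its fourth power times \<open>n\<close> diverges; any
  exponent strictly between -1/4 and 0 achieves this.\<close>

definition skip_prob :: "nat \<Rightarrow> real" where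
  "skip_prob n = real n powr (-1/8)"

definition remaining :: "nat \<Rightarrow> transcript \<Rightarrow> nat set" where
  "remaining m h = {1..m} - allocated h"

text \<open>The stored number is \<open>1\<close> for an agent who took a single valuable good and \<open>0\<close> otherwise.\<close>

definition singles :: "transcript \<Rightarrow> nat" where
  "singles h = (\<Sum>(u, B, c)\<leftarrow>h. c)"

definition valuable :: "nat \<Rightarrow> nat \<Rightarrow> transcript \<Rightarrow> valuation \<Rightarrow> nat \<Rightarrow> bool" where
  "valuable n m h u g \<longleftrightarrow> g \<in> remaining m h \<and> MMS n m u / 24 \<le> u {g}"

text \<open>The test uses only what is known on arrival. Its last clause is the drift needed for
  sampling to cost at most a fraction \<open>1 / (4 * u)\<close> of \<open>V\<close> on average,
  where \<open>u\<close> is \<open>n\<close> minus the singles; the lower bound on \<open>u\<close>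
  controls the second moments.\<close>

definition may_sample :: "nat \<Rightarrow> nat \<Rightarrow> transcript \<Rightarrow> valuation \<Rightarrow> bool" where
  "may_sample n m h u \<longleftrightarrow> 0 < MMS n m u \<and> skip_prob n * n / 2 \<le> real n - real (singles h) \<and>
     (\<forall>A\<subseteq>remaining m h. u A < MMS n m u / 24 \<longrightarrow>
        (real n - real (singles h)) * MMS n m u / 3 \<le> (\<Sum>g\<in>remaining m h - A. u (insert g A) - u A))"

definition serve :: "nat \<Rightarrow> nat \<Rightarrow> transcript \<Rightarrow> valuation \<Rightarrow> (nat set \<times> nat) pmf" where
  "serve n m h u =
     (if \<exists>g. valuable n m h u g then return_pmf ({SOME g. valuable n m h u g}, 1)
      else if may_sample n m h u
      then map_pmf (\<lambda>A. (A, 0))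
        (greedy_sample u (MMS n m u / 24) (remaining m h) (card (remaining m h)) {})
      else return_pmf ({}, 0))"

definition single_or_sample :: randomized_algorithm where
  "single_or_sample n m h u =
     bind_pmf (bernoulli_pmf (skip_prob n)) (\<lambda>s. if s then return_pmf ({}, 0) else serve n m h u)"

section \<open>Invariants and expectations along a run\<close>

lemma skip_prob_bounds: "1 \<le> n \<Longrightarrow> 0 < skip_prob n \<and> skip_prob n \<le> 1"
  by (auto simp: skip_prob_def powr_minus_divide divide_le_eq ge_one_powr_ge_zero)

lemma finite_remaining [simp]: "finite (remaining m h)"
  and remaining_subset: "remaining m h \<subseteq> {1..m}"
  and remaining_Nil [simp]: "remaining m [] = {1..m}"
  and remaining_append [simp]: "remaining m (h @ [(u, A, c)]) = remaining m h - A"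
  by (auto simp: remaining_def allocated_def)

lemma singles_Nil [simp]: "singles [] = 0"
  and singles_append [simp]: "singles (h @ [(u, A, c)]) = singles h + c"
  by (auto simp: singles_def)

lemma finite_serve: "finite (set_pmf (serve n m h u))"
  by (auto simp: serve_def intro!: finite_imageI finite_greedy_sample)

lemma finite_single_or_sample: "finite (set_pmf (single_or_sample n m h u))"
  by (auto simp: single_or_sample_def finite_serve)

lemma set_serve:
  assumes "(A, c) \<in> set_pmf (serve n m h u)"
  shows "A \<subseteq> remaining m h \<and> c \<le> 1"
proof (cases "\<exists>g. valuable n m h u g")
  case True
  have "(SOME g. valuable n m h u g) \<in> remaining m h"
    using someI_ex[OF True] by (simp add: valuable_def)
  then show ?thesis using True assms by (simp add: serve_def)
next
  case False
  then show ?thesis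
    using assms set_greedy_sample[of "remaining m h" "{}" u "MMS n m u / 24" "card (remaining m h)"]
    by (auto simp: serve_def split: if_splits)
qed

lemma set_single_or_sample:
  "(A, c) \<in> set_pmf (single_or_sample n m h u) \<Longrightarrow> A \<subseteq> remaining m h \<and> c \<le> 1"
  using set_serve[of A c n m h u] by (auto simp: single_or_sample_def split: if_splits)

lemma online_single_or_sample: "online_algorithm single_or_sample"
  using set_single_or_sample by (force simp: online_algorithm_def remaining_def)

lemma expectation_single_or_sample:
  assumes "1 \<le> n"
  shows "measure_pmf.expectation (single_or_sample n m h u) F =
    skip_prob n * F ({}, 0) + (1 - skip_prob n) * measure_pmf.expectation (serve n m h u) F"
  unfolding single_or_sample_def using skip_prob_bounds[OF assms]
  by (subst expectation_bind_finite) (auto simp: finite_serve mult.commute)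

lemma finite_run: "finite (set_pmf (run single_or_sample n m v t))"
  by (induction t) (auto intro!: finite_imageI finite_single_or_sample)

lemma set_run:
  "h \<in> set_pmf (run single_or_sample n m v t) \<Longrightarrow> length h = t \<and> singles h \<le> t"
proof (induction t arbitrary: h)
  case (Suc t)
  then show ?case by (force dest: set_single_or_sample)
qed simp

lemma expectation_run_Suc:
  fixes F :: "transcript \<Rightarrow> real"
  shows "measure_pmf.expectation (run single_or_sample n m v (Suc t)) F =
   measure_pmf.expectation (run single_or_sample n m v t)
     (\<lambda>h. measure_pmf.expectation (single_or_sample n m h (v (Suc t)))
       (\<lambda>(A, c). F (h @ [(v (Suc t), A, c)])))"
  unfolding run.simps
  by (subst expectation_bind_finite)
    (auto simp: finite_run finite_single_or_sample case_prod_unfold)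

text \<open>An additive drift bound: one-step increases of the expected potential add up. Only
  reachable transcripts occur, so the step may assume their invariants.\<close>

lemma expectation_run_le:
  assumes step: "\<And>t h. t < n \<Longrightarrow> length h = t \<Longrightarrow> singles h \<le> t \<Longrightarrow>
    measure_pmf.expectation (single_or_sample n m h (v (Suc t)))
       (\<lambda>(A, c). F (h @ [(v (Suc t), A, c)])) \<le> F h + C"
    and "t \<le> n"
  shows "measure_pmf.expectation (run single_or_sample n m v t) F \<le> F [] + real t * C"
  using \<open>t \<le> n\<close>
proof (induction t)
  case (Suc t)
  have "measure_pmf.expectation (run single_or_sample n m v (Suc t)) F
      \<le> measure_pmf.expectation (run single_or_sample n m v t) (\<lambda>h. F h + C)"
    unfolding expectation_run_Suc using Suc.prems set_run[of _ n m v t]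
    by (intro expectation_mono_finite finite_run step) auto
  also have "\<dots> = measure_pmf.expectation (run single_or_sample n m v t) F + C"
    by (simp add: integrable_measure_pmf_finite finite_run)
  also have "\<dots> \<le> F [] + real (Suc t) * C"
    using Suc by (simp add: algebra_simps)
  finally show ?case .
qed simp

text \<open>Later arrivals only append entries, so a quantity determined by the first
  \<open>i\<close> entries keeps its distribution.\<close>

lemma expectation_run_stable:
  assumes "i \<le> t" and F: "\<And>h x. i \<le> length h \<Longrightarrow> F (h @ [x]) = (F h :: real)"
  shows "measure_pmf.expectation (run single_or_sample n m v t) F =
    measure_pmf.expectation (run single_or_sample n m v i) F"
  using \<open>i \<le> t\<close>
proof (induction t rule: dec_induct)
  case (step t)
  have "measure_pmf.expectation (run single_or_sample n m v (Suc t)) F =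
      measure_pmf.expectation (run single_or_sample n m v t) F"
    unfolding expectation_run_Suc
  proof (intro integral_cong_AE)
    show "AE h in run single_or_sample n m v t.
       measure_pmf.expectation (single_or_sample n m h (v (Suc t)))
         (\<lambda>(A, c). F (h @ [(v (Suc t), A, c)])) = F h"
      unfolding AE_measure_pmf_iff
    proof
      fix h assume "h \<in> set_pmf (run single_or_sample n m v t)"
      then have "i \<le> length h" using set_run step by fastforce
      then show "measure_pmf.expectation (single_or_sample n m h (v (Suc t)))
         (\<lambda>(A, c). F (h @ [(v (Suc t), A, c)])) = F h"
        by (simp add: F case_prod_unfold)
    qed
  qed auto
  then show ?case using step by simp
qed simp

section \<open>Concentration of the number of singles\<close>

definition singles_excess :: "nat \<Rightarrow> transcript \<Rightarrow> real" where
  "singles_excess n h = real (singles h) - (1 - skip_prob n) * real (length h)"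

text \<open>An agent takes a single with probability at most \<open>1 - skip_prob n\<close>, so the
  excess has nonpositive drift and steps of size at most 1. The positive part is taken because a
  downward drift would let the plain square grow.\<close>

lemma singles_excess_step:
  assumes n: "1 \<le> n"
  shows "measure_pmf.expectation (single_or_sample n m h u)
      (\<lambda>(A, c). (max 0 (singles_excess n (h @ [(u, A, c)])))\<^sup>2) \<le> (max 0 (singles_excess n h))\<^sup>2 + 1"
proof -
  define e x where "e = skip_prob n" and "x = singles_excess n h"
  have e: "0 < e" "e \<le> 1" using skip_prob_bounds[OF n] by (auto simp: e_def)
  have X: "singles_excess n (h @ [(u, A, c)]) = x + real c - (1 - e)" for A c
    by (simp add: singles_excess_def x_def e_def algebra_simps)
  have "measure_pmf.expectation (serve n m h u) (\<lambda>(A, c). (max 0 (x + real c - (1 - e)))\<^sup>2)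
      \<le> measure_pmf.expectation (serve n m h u) (\<lambda>_. (max 0 (x + e))\<^sup>2)"
    using e by (intro expectation_mono_finite finite_serve)
      (auto dest!: set_serve intro!: power_mono)
  from mult_left_mono[OF this, of "1 - e"]
  have "measure_pmf.expectation (single_or_sample n m h u)
      (\<lambda>(A, c). (max 0 (singles_excess n (h @ [(u, A, c)])))\<^sup>2)
      \<le> e * (max 0 (x - (1 - e)))\<^sup>2 + (1 - e) * (max 0 (x + e))\<^sup>2"
    using e unfolding X expectation_single_or_sample[OF n] e_def[symmetric] by simp
  also have "\<dots> \<le> (max 0 x)\<^sup>2 + 1"
  proof (cases "0 \<le> x")
    case True
    have "e * (max 0 (x - (1 - e)))\<^sup>2 + (1 - e) * (max 0 (x + e))\<^sup>2
        \<le> e * (x - (1 - e))\<^sup>2 + (1 - e) * (x + e)\<^sup>2"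
      using e by (intro add_mono mult_left_mono) (auto simp: max_def)
    \<comment> \<open>The linear terms cancel: steps of \<open>-(1 - e)\<close> with probability
      \<open>e\<close> and of \<open>e\<close> otherwise have mean 0, which leaves the
      variance.\<close>
    also have "\<dots> = x\<^sup>2 + e * (1 - e)" by (simp add: algebra_simps power2_eq_square)
    also have "e * (1 - e) \<le> 1" using e by (intro mult_le_one) auto
    finally show ?thesis using True by simp
  next
    case False
    then have "(max 0 (x + e))\<^sup>2 \<le> 1" "(max 0 (x - (1 - e)))\<^sup>2 = 0"
      using e by (auto intro!: power_le_one)
    then have "e * (max 0 (x - (1 - e)))\<^sup>2 + (1 - e) * (max 0 (x + e))\<^sup>2 \<le> 1"
      using e mult_le_one[of "1 - e" "(max 0 (x + e))\<^sup>2"] by auto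
    then show ?thesis by (smt (verit) zero_le_power2)
  qed
  finally show ?thesis by (simp add: x_def)
qed

section \<open>The goods left over for an agent\<close>

text \<open>
  \<open>V\<close> measures the goods from the perspective of a later agent: \<open>N\<close> of her bundles consist of goods
  of little value to her and count up to \<open>1\<close> each, the others are represented by one valuable
  good that counts \<open>1/2\<close>.
\<close>

locale goods_supply =
  fixes n m :: nat and N :: real and V :: "nat set \<Rightarrow> real"
  assumes N: "0 \<le> N" "N \<le> n"
    and submodular: "submodular_on {1..m} V"
    and monotone: "mono_on (Pow {1..m}) V"
    and nonneg: "0 \<le> V {}"
    and unit: "\<And>S g. S \<subseteq> {1..m} \<Longrightarrow> g \<in> S \<Longrightarrow> V S - V (S - {g}) \<le> 1/2"
    and total: "V {1..m} = (n + N) / 2"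
begin

text \<open>
  With \<open>u\<close> for \<open>n - singles h\<close>, a single lowers \<open>(u + N) / 2\<close> by \<open>1/2\<close> and \<open>V\<close> by no more; a sample
  costs a \<open>1 / (4 * u)\<close> fraction of \<open>V\<close>, which the last two terms pay for.
\<close>

definition deficit :: "transcript \<Rightarrow> real" where
  "deficit h = (let u = real n - real (singles h); k = real (length h) - real (singles h) in
     (u + N) / 2 - V (remaining m h) - k / 8 - N * k / (8 * u))"

lemma deficit_Nil [simp]: "deficit [] = 0"
  using total by (simp add: deficit_def)

lemma V_mono: "S \<subseteq> T \<Longrightarrow> T \<subseteq> {1..m} \<Longrightarrow> V S \<le> V T"
  using mono_onD[OF monotone, of S T] by auto

lemma V_remaining: "0 \<le> V (remaining m h)" "V (remaining m h) \<le> n"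
  using V_mono[of "{}" "remaining m h"] V_mono[of "remaining m h" "{1..m}"] nonneg total N
    remaining_subset[of m h] by auto

text \<open>The allowance \<open>1/8 + N / (8 * u)\<close> is the fraction
  \<open>1 / (4 * u)\<close> of \<open>(u + N) / 2\<close>, the predicted mean cost of a
  sample.\<close>

lemma deficit_no_single:
  "deficit (h @ [(u, A, 0)]) = deficit h + (V (remaining m h) - V (remaining m h - A))
     - (1/8 + N / (8 * (real n - real (singles h))))"
  by (simp add: deficit_def Let_def add_divide_distrib diff_divide_distrib algebra_simps)

lemma deficit_single:
  assumes h: "singles h \<le> length h" "length h < n" and g: "g \<in> remaining m h"
  shows "deficit (h @ [(u, {g}, 1)]) \<le> deficit h"
proof -
  define w k where "w = real n - real (singles h)" and "k = real (length h) - real (singles h)"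
  have wk: "0 \<le> k" "k \<le> w - 1" using h by (auto simp: w_def k_def)
  \<comment> \<open>The case \<open>k = 0\<close> is separate because \<open>w - 1\<close> may then
    be 0; otherwise it is at least \<open>k\<close> and thus positive.\<close>
  have "k / (8 * w) \<le> k / (8 * (w - 1))"
    using wk by (cases "k = 0") (auto intro!: divide_left_mono)
  then have "N * (k / (8 * w)) \<le> N * (k / (8 * (w - 1)))"
    using N(1) by (rule mult_left_mono)
  moreover have "V (remaining m h) - V (remaining m h - {g}) \<le> 1/2"
    using unit[OF remaining_subset g] .
  moreover have "deficit h = (w + N) / 2 - V (remaining m h) - k / 8 - N * (k / (8 * w))"
    by (simp add: deficit_def w_def k_def Let_def)
  moreover have "deficit (h @ [(u, {g}, 1)]) =
      (w - 1 + N) / 2 - V (remaining m h - {g}) - k / 8 - N * (k / (8 * (w - 1)))"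
    by (simp add: deficit_def w_def k_def Let_def algebra_simps)
  ultimately show ?thesis by argo
qed

lemma deficit_no_gift:
  assumes "singles h \<le> n"
  shows "deficit (h @ [(u, {}, 0)]) \<le> deficit h"
proof -
  have "0 \<le> N / (8 * (real n - real (singles h)))" using N assms by simp
  then show ?thesis unfolding deficit_no_single by simp
qed

text \<open>Only sampling can raise the deficit. If the deficit is nonnegative, \<open>V\<close> is
  at most its prediction, so the mean loss is covered by the allowance and only second moments
  remain. If it is negative, the new positive part is at most the loss itself.\<close>

lemma deficit_serve:
  assumes n: "1 \<le> n" and h: "singles h \<le> length h" "length h < n"
    and u: "\<And>S. S \<subseteq> {1..m} \<Longrightarrow> 0 \<le> u S" "mono_on (Pow {1..m}) u" "submodular_on {1..m} u"
  shows "measure_pmf.expectation (serve n m h u) (\<lambda>(A, c). (max 0 (deficit (h @ [(u, A, c)])))\<^sup>2)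
    \<le> (max 0 (deficit h))\<^sup>2 + 2 / (skip_prob n)\<^sup>2"
proof -
  define e where "e = skip_prob n"
  have e: "0 < e" "e \<le> 1" using skip_prob_bounds[OF n] by (auto simp: e_def)
  have le: "(max 0 y)\<^sup>2 \<le> (max 0 (deficit h))\<^sup>2 + 2 / e\<^sup>2" if "y \<le> deficit h" for y
  proof -
    have "(max 0 y)\<^sup>2 \<le> (max 0 (deficit h))\<^sup>2" using that by (intro power_mono) auto
    moreover have "0 \<le> 2 / e\<^sup>2" by simp
    ultimately show ?thesis by linarith
  qed
  consider (single) "\<exists>g. valuable n m h u g"
    | (sample) "\<nexists>g. valuable n m h u g" "may_sample n m h u"
    | (none) "\<nexists>g. valuable n m h u g" "\<not> may_sample n m h u"
    by blast
  then show ?thesis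
  proof cases
    case single
    then have "(SOME g. valuable n m h u g) \<in> remaining m h"
      using someI_ex[OF single] by (simp add: valuable_def)
    from le[OF deficit_single[OF h this]] show ?thesis
      using single by (simp add: serve_def e_def)
  next
    case none
    have "singles h \<le> n" using h by simp
    from le[OF deficit_no_gift[OF this]] none show ?thesis
      by (simp add: serve_def e_def)
  next
    case sample
    define R \<mu> \<theta> w where "R = remaining m h" and "\<mu> = MMS n m u" and "\<theta> = \<mu> / 24"
      and "w = real n - real (singles h)"
    define S where "S = greedy_sample u \<theta> R (card R) {}"
    define D where "D A = V R - V (R - A)" for A
    define inc z b where "inc = 1/8 + N / (8 * w)" and "z = deficit h" and "b = V R"
    have R: "R \<subseteq> {1..m}" "finite R" unfolding R_def by (rule remaining_subset, rule finite_remaining)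
    have \<mu>: "0 < \<mu>" and w: "e * n / 2 \<le> w"
      and drift: "\<And>A. A \<subseteq> R \<Longrightarrow> u A < \<theta> \<Longrightarrow> w * \<mu> / 3 \<le> (\<Sum>g\<in>R - A. u (insert g A) - u A)"
      using sample(2) unfolding may_sample_def R_def \<mu>_def \<theta>_def w_def e_def by blast+
    have "0 < e * n / 2" using e n by simp
    with w have w0: "0 < w" by linarith
    have "Pow R \<subseteq> Pow {1..m}" using R(1) by (rule Pow_mono)
    then have subs: "mono_on (Pow R) u" "mono_on (Pow R) V"
      using u(2) monotone by (blast intro: mono_on_subset)+
    have subV: "submodular_on R V"
      using submodular R(1) unfolding submodular_on_def by (meson subset_trans)
    \<comment> \<open>No valuable good is left, so a single addition gains less than
      \<open>\<theta>\<close>.\<close>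
    have small: "u (insert g A) \<le> 2 * \<theta>" if "A \<subseteq> R" "u A < \<theta>" "g \<in> R - A" for A g
    proof -
      have "u (A \<union> {g}) + u (A \<inter> {g}) \<le> u A + u {g}"
        by (rule submodular_onD[OF u(3)]) (use that R in auto)
      moreover have "0 \<le> u (A \<inter> {g})" using that R by (intro u(1)) auto
      moreover have "u {g} < \<theta>"
        using sample(1) that by (auto simp: valuable_def R_def \<theta>_def \<mu>_def)
      ultimately show ?thesis using that by simp
    qed
    have unit1: "V S - V (S - {g}) \<le> 1" if "S \<subseteq> R" "g \<in> S" for S g
      using unit[OF subset_trans[OF that(1) R(1)] that(2)] by simp
    have pos: "0 < w * \<mu> / 3" "0 \<le> \<theta>" "0 \<le> u {}"
      using \<mu> w0 u(1) by (auto simp: \<theta>_def)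
    note sampling = R(2) pos(1,2) subs(1) pos(3) drift small subV subs(2) nonneg unit1
    have q: "2 * \<theta> / (w * \<mu> / 3) = 1 / (4 * w)"
      using \<mu> by (simp add: \<theta>_def field_simps)
    have mean: "measure_pmf.expectation S D \<le> b / (4 * w)"
      using greedy_sample_mean[OF sampling, of "card R"] unfolding q
      by (simp add: S_def D_def[abs_def] b_def)
    have second: "measure_pmf.expectation S (\<lambda>A. (D A)\<^sup>2) \<le> b / (4 * w) + 2 * (b / (4 * w))\<^sup>2"
      using greedy_sample_second_moment[OF sampling, of "card R"] unfolding q
      by (simp add: S_def D_def[abs_def] b_def)
    have finS: "finite (set_pmf S)" using R by (simp add: S_def finite_greedy_sample)
    have D0: "0 \<le> D A" for A
      using V_mono[of "R - A" R] R by (auto simp: D_def)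
    have b: "0 \<le> b" "b \<le> n" using V_remaining by (auto simp: b_def R_def)
    \<comment> \<open>This is where the lower bound \<open>e * n / 2\<close> on \<open>w\<close>
      enters; it bounds both the mean loss and the allowance by \<open>1 / (2 * e)\<close>.\<close>
    have frac: "y / (4 * w) \<le> 1 / (2 * e)" if "y \<le> n" for y :: real
    proof -
      have "y * (2 * e) \<le> n * (2 * e)" using that e by simp
      also have "\<dots> \<le> 4 * w" using w by simp
      finally show ?thesis using w0 e by (simp add: field_simps)
    qed
    have bq: "0 \<le> b / (4 * w)" "b / (4 * w) \<le> 1 / (2 * e)" using b w0 frac by auto
    have inc_eq: "inc = (w + N) / 2 / (4 * w)" using w0 by (simp add: inc_def field_simps)
    have "w \<le> n" by (simp add: w_def)
    then have incb: "0 \<le> inc" "inc \<le> 1 / (2 * e)"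
      unfolding inc_eq using N w0 frac[of "(w + N) / 2"] by simp_all
    have e2: "1 / (2 * e) \<le> 1 / (2 * e\<^sup>2)" "(1 / (2 * e))\<^sup>2 = 1 / (4 * e\<^sup>2)"
      using e by (auto simp: field_simps power2_eq_square)
    have sq: "(b / (4 * w))\<^sup>2 \<le> 1 / (4 * e\<^sup>2)" "inc\<^sup>2 \<le> 1 / (4 * e\<^sup>2)"
      unfolding e2(2)[symmetric] using bq incb by (auto intro!: power_mono)
    have moment: "measure_pmf.expectation S (\<lambda>A. (D A)\<^sup>2) + inc\<^sup>2 \<le> 2 / e\<^sup>2"
    proof -
      have "measure_pmf.expectation S (\<lambda>A. (D A)\<^sup>2) + inc\<^sup>2 \<le> 1 / (2 * e\<^sup>2) + 2 * (1 / (4 * e\<^sup>2)) + 1 / (4 * e\<^sup>2)"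
        using second bq(2) e2(1) sq by linarith
      also have "\<dots> \<le> 2 / e\<^sup>2" using e by (simp add: field_simps)
      finally show ?thesis .
    qed
    have "measure_pmf.expectation (serve n m h u) (\<lambda>(A, c). (max 0 (deficit (h @ [(u, A, c)])))\<^sup>2)
        = measure_pmf.expectation S (\<lambda>A. (max 0 (z + D A - inc))\<^sup>2)"
      using sample
      by (simp add: serve_def S_def R_def \<mu>_def \<theta>_def deficit_no_single D_def z_def inc_def w_def)
    also have "\<dots> \<le> (max 0 z)\<^sup>2 + 2 / e\<^sup>2"
    proof (cases "0 \<le> z")
      case True
      \<comment> \<open>The terms for past non-single agents enter the deficit negatively, so a
        nonnegative deficit leaves at most \<open>(w + N) / 2\<close> for \<open>V\<close>.\<close>
      have "b \<le> (w + N) / 2"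
      proof -
        have k: "0 \<le> real (length h) - real (singles h)" using h by simp
        then have "0 \<le> N * (real (length h) - real (singles h)) / (8 * w)"
          using N w0 by simp
        moreover have "0 \<le> (w + N) / 2 - b - (real (length h) - real (singles h)) / 8
            - N * (real (length h) - real (singles h)) / (8 * w)"
          using True unfolding z_def deficit_def Let_def w_def b_def R_def .
        moreover have "b \<le> x" if "0 \<le> x - b - y / 8 - c" "0 \<le> y" "0 \<le> c" for x y c :: real
          using that by simp
        ultimately show ?thesis using k by blast
      qed
      then have "b / (4 * w) \<le> inc" unfolding inc_eq using w0 by (intro divide_right_mono) auto
      with mean have drop: "measure_pmf.expectation S D \<le> inc" by simp
      have "measure_pmf.expectation S (\<lambda>A. (max 0 (z + D A - inc))\<^sup>2)
          \<le> measure_pmf.expectation S (\<lambda>A. (z\<^sup>2 - 2 * z * inc + inc\<^sup>2) + 2 * z * D A + (D A)\<^sup>2)"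
      proof (rule expectation_mono_finite[OF finS])
        fix A
        have "0 \<le> D A * inc" using D0 incb by simp
        moreover have "(max 0 (z + D A - inc))\<^sup>2 \<le> (z + D A - inc)\<^sup>2" by (auto simp: max_def)
        ultimately show "(max 0 (z + D A - inc))\<^sup>2 \<le> (z\<^sup>2 - 2 * z * inc + inc\<^sup>2) + 2 * z * D A + (D A)\<^sup>2"
          by (simp add: algebra_simps power2_eq_square)
      qed
      also have "\<dots> = z\<^sup>2 - 2 * z * inc + inc\<^sup>2 + 2 * z * measure_pmf.expectation S D
          + measure_pmf.expectation S (\<lambda>A. (D A)\<^sup>2)"
        by (simp add: integrable_measure_pmf_finite finS)
      also have "\<dots> \<le> z\<^sup>2 + 2 / e\<^sup>2"
        using moment mult_left_mono[OF drop, of "2 * z"] True by simp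
      finally show ?thesis using True by simp
    next
      case False
      have "measure_pmf.expectation S (\<lambda>A. (max 0 (z + D A - inc))\<^sup>2)
          \<le> measure_pmf.expectation S (\<lambda>A. (D A)\<^sup>2)"
        using False D0 incb by (intro expectation_mono_finite[OF finS] power_mono) (auto simp: max_def)
      also have "\<dots> \<le> 2 / e\<^sup>2" using moment by (smt (verit) zero_le_power2)
      finally show ?thesis using False by simp
    qed
    finally show ?thesis by (simp add: z_def e_def)
  qed
qed

lemma deficit_step:
  assumes n: "1 \<le> n" and h: "singles h \<le> length h" "length h < n"
    and u: "\<And>S. S \<subseteq> {1..m} \<Longrightarrow> 0 \<le> u S" "mono_on (Pow {1..m}) u" "submodular_on {1..m} u"
  shows "measure_pmf.expectation (single_or_sample n m h u)
      (\<lambda>(A, c). (max 0 (deficit (h @ [(u, A, c)])))\<^sup>2) \<le> (max 0 (deficit h))\<^sup>2 + 2 / (skip_prob n)\<^sup>2"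
proof -
  let ?B = "(max 0 (deficit h))\<^sup>2 + 2 / (skip_prob n)\<^sup>2"
  have "singles h \<le> n" using h by simp
  from deficit_no_gift[OF this, of u]
  have "(max 0 (deficit (h @ [(u, {}, 0)])))\<^sup>2 \<le> (max 0 (deficit h))\<^sup>2" by (intro power_mono) auto
  also have "\<dots> \<le> ?B" by simp
  finally have 1: "(max 0 (deficit (h @ [(u, {}, 0)])))\<^sup>2 \<le> ?B" .
  have e: "0 \<le> skip_prob n" "0 \<le> 1 - skip_prob n" using skip_prob_bounds[OF n] by auto
  have "skip_prob n * x + (1 - skip_prob n) * y \<le> ?B" if "x \<le> ?B" "y \<le> ?B" for x y
    using convex_bound_le[OF that e] by simp
  from this[OF 1 deficit_serve[OF n h u]] show ?thesis
    unfolding expectation_single_or_sample[OF n] prod.case .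
qed

text \<open>
  The worst case is \<open>length h = n\<close>, where the slack is \<open>1/2 - 1/8 - 1/3 = 1/24\<close> in \<open>u\<close> and
  \<open>1/2 - 1/8 - 1/24 = 1/3\<close> in \<open>N\<close>.
\<close>

lemma deficit_ge:
  assumes h: "length h \<le> n" "singles h < n"
    and low: "V (remaining m h) < N / 24 + (real n - real (singles h)) / 3"
  shows "(real n - real (singles h)) / 24 \<le> deficit h"
proof -
  define w k where "w = real n - real (singles h)" and "k = real (length h) - real (singles h)"
  have wk: "0 < w" "k \<le> w" using h by (auto simp: w_def k_def)
  then have "N * (k / (8 * w)) \<le> N * (1 / 8)"
    using N by (intro mult_left_mono) (auto simp: divide_le_eq)
  moreover have "deficit h = (w + N) / 2 - V (remaining m h) - k / 8 - N * (k / (8 * w))"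
    by (simp add: deficit_def w_def k_def Let_def)
  moreover have "V (remaining m h) < N / 24 + w / 3" using low by (simp add: w_def)
  moreover have "(w + N) / 2 = w / 2 + N / 2" by simp
  ultimately show ?thesis using wk N unfolding w_def[symmetric] by linarith
qed

end

section \<open>The supply function of a maximin partition\<close>

lemma MMS_attained:
  assumes "1 \<le> n"
  shows "\<exists>P\<in>bundle_partitions n m. \<forall>l\<in>{1..n}. MMS n m v \<le> v (P l)"
proof -
  let ?f = "\<lambda>P. Min ((\<lambda>l. v (P l)) ` {1..n})"
  have "bundle_partitions n m \<subseteq> {1..n} \<rightarrow>\<^sub>E Pow {1..m}"
    by (auto simp: bundle_partitions_def)
  then have fin: "finite (bundle_partitions n m)"
    by (rule finite_subset) (simp add: finite_PiE)
  \<comment> \<open>Giving everything to the first bundle shows that partitions exist.\<close>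
  have "(\<lambda>l\<in>{1..n}. if l = 1 then {1..m} else {}) \<in> bundle_partitions n m"
    using assms by (auto simp: bundle_partitions_def disjoint_family_on_def split: if_splits)
  then have "bundle_partitions n m \<noteq> {}" by blast
  then have "MMS n m v \<in> ?f ` bundle_partitions n m"
    using fin unfolding MMS_def by (intro Max_in) auto
  then obtain P where P: "P \<in> bundle_partitions n m" "MMS n m v = ?f P" by blast
  then have "MMS n m v \<le> v (P l)" if "l \<in> {1..n}" for l
    using that by simp
  with P(1) show ?thesis by blast
qed

text \<open>\<open>V\<close> is built from an MMS partition, and \<open>N\<close> counts its bundles
  without a good worth \<open>MMS / 24\<close>. Once no valuable good remains, only these bundles
  contribute to \<open>V\<close>, and a large \<open>V\<close> forces large total marginals on top
  of any \<open>A\<close> below the threshold.\<close>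

lemma goods_supply_exists:
  assumes n: "1 \<le> n"
    and u: "\<And>S. S \<subseteq> {1..m} \<Longrightarrow> 0 \<le> u S" "mono_on (Pow {1..m}) u" "submodular_on {1..m} u"
    and pos: "0 < MMS n m u"
  obtains N V where "goods_supply n m N V"
    and "\<And>h. \<nexists>g. valuable n m h u g \<Longrightarrow> skip_prob n * n / 2 \<le> real n - real (singles h) \<Longrightarrow>
           N / 24 + (real n - real (singles h)) / 3 \<le> V (remaining m h) \<Longrightarrow> may_sample n m h u"
proof -
  define \<mu> where "\<mu> = MMS n m u"
  have \<mu>: "0 < \<mu>" using pos by (simp add: \<mu>_def)
  obtain P where P: "P \<in> bundle_partitions n m" and share: "\<And>l. l \<in> {1..n} \<Longrightarrow> \<mu> \<le> u (P l)"
    using MMS_attained[OF n] unfolding \<mu>_def by blast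
  have Psub: "P l \<subseteq> {1..m}" if "l \<in> {1..n}" for l
    using P that by (auto simp: bundle_partitions_def PiE_iff)
  have Pdisj: "P k \<inter> P l = {}" if "k \<in> {1..n}" "l \<in> {1..n}" "k \<noteq> l" for k l
    using P that by (auto simp: bundle_partitions_def disjoint_family_on_def)
  have Pcover: "\<exists>l\<in>{1..n}. g \<in> P l" if "g \<in> {1..m}" for g
    using P that by (auto simp: bundle_partitions_def)
  have mono: "u S \<le> u T" if "S \<subseteq> T" "T \<subseteq> {1..m}" for S T
    using mono_onD[OF u(2), of S T] that by auto
  define B where "B = {l \<in> {1..n}. \<exists>g\<in>P l. \<mu> / 24 \<le> u {g}}"
  define L where "L = {1..n} - B"
  define b where "b l = (SOME g. g \<in> P l \<and> \<mu> / 24 \<le> u {g})" for l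
  have b: "b l \<in> P l \<and> \<mu> / 24 \<le> u {b l}" if "l \<in> B" for l
    unfolding b_def by (rule someI_ex) (use that in \<open>auto simp: B_def\<close>)
  \<comment> \<open>Dividing by \<open>\<mu>\<close> and capping at 1 makes the initial contribution
    of a bundle outside \<open>B\<close> exactly 1.\<close>
  define f where "f l S = (if l \<in> B then if b l \<in> S then 1/2 else 0 else min (u (P l \<inter> S) / \<mu>) 1)" for l S
  define V where "V S = (\<Sum>l\<in>{1..n}. f l S)" for S
  have split: "(\<Sum>l\<in>{1..n}. F l) = (\<Sum>l\<in>B. F l) + (\<Sum>l\<in>L. F l)" for F :: "nat \<Rightarrow> real"
    unfolding L_def by (subst sum.subset_diff[of B]) (auto simp: B_def)
  have n_card: "real n = card B + card L"
    using split[of "\<lambda>_. 1"] by simp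
  have fmono: "f l S \<le> f l T" if "S \<subseteq> T" "T \<subseteq> {1..m}" for l S T
  proof -
    have "u (P l \<inter> S) \<le> u (P l \<inter> T)" using that by (intro mono) auto
    then have "u (P l \<inter> S) / \<mu> \<le> u (P l \<inter> T) / \<mu>" using \<mu> by (simp add: divide_right_mono)
    then show ?thesis using that by (auto simp: f_def)
  qed
  have "goods_supply n m (card L) V"
  proof
    show "0 \<le> real (card L)" "real (card L) \<le> n" using n_card by auto
    show "submodular_on {1..m} V"
      unfolding V_def
    proof (rule submodular_on_sum)
      fix l
      show "submodular_on {1..m} (f l)"
      proof (cases "l \<in> B")
        case True
        then show ?thesis by (auto simp: submodular_on_def f_def)
      next
        case False
        then have "f l = (\<lambda>S. min (u (P l \<inter> S) / \<mu>) 1)" by (auto simp: f_def)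
        then show ?thesis using submodular_on_cap[OF u(3,2) \<mu>] by simp
      qed
    qed
    show "mono_on (Pow {1..m}) V"
      unfolding V_def by (auto intro!: mono_onI sum_mono fmono)
    show "0 \<le> V {}"
      unfolding V_def using u(1)[of "{}"] \<mu> by (auto simp: f_def intro!: sum_nonneg)
    show "V S - V (S - {g}) \<le> 1/2" if S: "S \<subseteq> {1..m}" "g \<in> S" for S g
    proof -
      obtain k where k: "k \<in> {1..n}" "g \<in> P k" using Pcover S by blast
      \<comment> \<open>The bundles are disjoint, so removing \<open>g\<close> affects only the
        bundle that contains it.\<close>
      have "f l (S - {g}) = f l S" if "l \<in> {1..n} - {k}" for l
      proof -
        have "g \<notin> P l" using Pdisj[of k l] k that by auto
        moreover from this have "P l \<inter> (S - {g}) = P l \<inter> S" by auto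
        ultimately show ?thesis using b by (auto simp: f_def)
      qed
      then have "V S - V (S - {g}) = f k S - f k (S - {g})"
        unfolding V_def using k by (simp add: sum.remove[of _ k])
      also have "\<dots> \<le> 1/2"
      proof (cases "k \<in> B")
        case False
        then have g: "u {g} < \<mu> / 24" using k by (auto simp: B_def not_le)
        have eq: "(P k \<inter> (S - {g})) \<union> {g} = P k \<inter> S" "(P k \<inter> (S - {g})) \<inter> {g} = {}"
          using k S by auto
        have "u ((P k \<inter> (S - {g})) \<union> {g}) + u ((P k \<inter> (S - {g})) \<inter> {g}) \<le> u (P k \<inter> (S - {g})) + u {g}"
          by (rule submodular_onD[OF u(3)]) (use S in auto)
        then have "u (P k \<inter> S) \<le> u (P k \<inter> (S - {g})) + \<mu> / 2"
          unfolding eq using g u(1)[of "{}"] \<mu> by simp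
        then have "u (P k \<inter> S) / \<mu> \<le> u (P k \<inter> (S - {g})) / \<mu> + 1/2"
          using \<mu> by (simp add: field_simps)
        moreover have "min x 1 - min y 1 \<le> 1/2" if "x \<le> y + 1/2" for x y :: real
          using that by (simp add: min_def)
        ultimately show ?thesis using False by (simp add: f_def)
      qed (auto simp: f_def)
      finally show ?thesis .
    qed
    have "f l {1..m} = (if l \<in> B then 1/2 else 1)" if "l \<in> {1..n}" for l
    proof (cases "l \<in> B")
      case True
      then show ?thesis using b[OF True] Psub[OF that] by (auto simp: f_def)
    next
      case False
      have "P l \<inter> {1..m} = P l" using Psub[OF that] by auto
      then show ?thesis using False share[OF that] \<mu> by (simp add: f_def)
    qed
    then have "V {1..m} = (\<Sum>l\<in>{1..n}. if l \<in> B then 1/2 else 1)"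
      unfolding V_def by (rule sum.cong[OF refl])
    also have "\<dots> = card B / 2 + card L"
      unfolding split by (simp add: L_def)
    finally show "V {1..m} = (n + real (card L)) / 2" using n_card by simp
  qed
  moreover have "may_sample n m h u"
    if small: "\<nexists>g. valuable n m h u g" and "skip_prob n * n / 2 \<le> real n - real (singles h)"
      and rich: "card L / 24 + (real n - real (singles h)) / 3 \<le> V (remaining m h)" for h
    unfolding may_sample_def
  proof (intro conjI allI impI)
    define R where "R = remaining m h"
    have R: "R \<subseteq> {1..m}" "finite R" by (auto simp: R_def remaining_def)
    \<comment> \<open>A remaining representative would itself be valuable, so the bundles in
      \<open>B\<close> now contribute nothing.\<close>
    have "b l \<notin> R" if "l \<in> B" for l
      using small b[OF that] by (auto simp: valuable_def R_def \<mu>_def)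
    then have VR: "V R = (\<Sum>l\<in>L. min (u (P l \<inter> R) / \<mu>) 1)"
      unfolding V_def split by (simp add: f_def L_def)
    fix A assume A: "A \<subseteq> remaining m h" "u A < MMS n m u / 24"
    then have AR: "A \<subseteq> R" "u A \<le> \<mu> / 24" by (auto simp: R_def \<mu>_def)
    have "(real n - real (singles h)) / 3 * \<mu> \<le> (V R - card L / 24) * \<mu>"
    proof (rule mult_right_mono)
      show "(real n - real (singles h)) / 3 \<le> V R - card L / 24"
        using rich unfolding R_def by linarith
    qed (use \<mu> in simp)
    \<comment> \<open>The reserve \<open>card L / 24\<close> becomes \<open>\<mu> / 24\<close> per
      bundle, which pays for subtracting \<open>u A\<close> in each bundle separately.\<close>
    also have "\<dots> = (\<Sum>l\<in>L. \<mu> * min (u (P l \<inter> R) / \<mu>) 1 - \<mu> / 24)"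
      unfolding VR by (simp add: sum_subtractf sum_distrib_left algebra_simps)
    also have "\<dots> \<le> (\<Sum>l\<in>L. \<Sum>g\<in>P l \<inter> R - A. u (insert g A) - u A)"
    proof (rule sum_mono)
      fix l
      have "\<mu> * min (u (P l \<inter> R) / \<mu>) 1 \<le> \<mu> * (u (P l \<inter> R) / \<mu>)"
        using \<mu> by (intro mult_left_mono) auto
      also have "\<dots> = u (P l \<inter> R)" using \<mu> by simp
      also have "\<dots> \<le> u (A \<union> (P l \<inter> R - A))" using AR R by (intro mono) auto
      finally have "\<mu> * min (u (P l \<inter> R) / \<mu>) 1 - \<mu> / 24 \<le> u (A \<union> (P l \<inter> R - A)) - u A"
        using AR by simp
      also have "\<dots> \<le> (\<Sum>g\<in>P l \<inter> R - A. u (insert g A) - u A)"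
        by (rule sum_marginal_ge[OF u(3)]) (use AR R in auto)
      finally show "\<mu> * min (u (P l \<inter> R) / \<mu>) 1 - \<mu> / 24 \<le> (\<Sum>g\<in>P l \<inter> R - A. u (insert g A) - u A)" .
    qed
    also have "\<dots> = (\<Sum>g\<in>(\<Union>l\<in>L. P l \<inter> R - A). u (insert g A) - u A)"
    proof (rule sum.UNION_disjoint[symmetric])
      show "\<forall>k\<in>L. \<forall>l\<in>L. k \<noteq> l \<longrightarrow> (P k \<inter> R - A) \<inter> (P l \<inter> R - A) = {}"
        using Pdisj unfolding L_def by blast
    qed (use R in \<open>auto simp: L_def\<close>)
    also have "\<dots> \<le> (\<Sum>g\<in>R - A. u (insert g A) - u A)"
      using R AR by (intro sum_mono2) (auto intro!: mono)
    finally show "(real n - real (singles h)) * MMS n m u / 3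
        \<le> (\<Sum>g\<in>remaining m h - A. u (insert g A) - u A)"
      by (simp add: R_def \<mu>_def)
  qed (use that pos in auto)
  ultimately show thesis by (rule that)
qed

section \<open>The success probability\<close>

text \<open>In the sampling case the remaining goods reach the threshold together; otherwise the
  drift condition at \<open>A\<close> equal to all of them would make an empty sum positive.\<close>

lemma serve_success:
  assumes u: "\<And>S. S \<subseteq> {1..m} \<Longrightarrow> 0 \<le> u S"
    and can: "(\<exists>g. valuable n m h u g) \<or> may_sample n m h u" and n: "singles h < n"
    and A: "(A, c) \<in> set_pmf (serve n m h u)"
  shows "MMS n m u / 24 \<le> u A"
proof (cases "\<exists>g. valuable n m h u g")
  case True
  then have "A = {SOME g. valuable n m h u g}" using A by (simp add: serve_def)
  then show ?thesis using someI_ex[OF True] unfolding valuable_def[of _ _ _ _ "Eps _"] by blast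
next
  case False
  let ?R = "remaining m h"
  have sample: "may_sample n m h u" using can False by blast
  have "MMS n m u / 24 \<le> u ?R"
  proof (rule ccontr)
    assume "\<not> MMS n m u / 24 \<le> u ?R"
    then have "(real n - real (singles h)) * MMS n m u / 3 \<le> (\<Sum>g\<in>?R - ?R. u (insert g ?R) - u ?R)"
      using sample unfolding may_sample_def by (meson not_le order_refl)
    moreover have "0 < (real n - real (singles h)) * MMS n m u / 3"
      using sample n by (simp add: may_sample_def)
    ultimately show False by simp
  qed
  then show ?thesis
    using greedy_sample_reaches[of ?R "{}" "card ?R" "MMS n m u / 24" u A] A False sample
    by (auto simp: serve_def)
qed

text \<open>Apart from skipping, failure requires that many singles were taken, so the excess is at
  least \<open>e * n / 2\<close>, or that \<open>V\<close> is low, so the deficit is at least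
  \<open>e * n / 48\<close>, with \<open>e\<close> the skip probability. Both are charged to squares
  as in Chebyshev's inequality.\<close>

lemma (in goods_supply) failure_le:
  assumes n: "1 \<le> n" and h: "singles h \<le> length h" "length h < n"
    and u: "\<And>S. S \<subseteq> {1..m} \<Longrightarrow> 0 \<le> u S"
    and enough: "\<nexists>g. valuable n m h u g \<Longrightarrow> skip_prob n * n / 2 \<le> real n - real (singles h) \<Longrightarrow>
           N / 24 + (real n - real (singles h)) / 3 \<le> V (remaining m h) \<Longrightarrow> may_sample n m h u"
  shows "measure_pmf.expectation (single_or_sample n m h u) (\<lambda>(A, c). of_bool (u A < MMS n m u / 24))
    \<le> skip_prob n + (48 / (skip_prob n * n))\<^sup>2 * (max 0 (deficit h))\<^sup>2
        + (2 / (skip_prob n * n))\<^sup>2 * (max 0 (singles_excess n h))\<^sup>2"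
proof -
  define e s t where "e = skip_prob n" and "s = (48 / (e * n))\<^sup>2 * (max 0 (deficit h))\<^sup>2"
    and "t = (2 / (e * n))\<^sup>2 * (max 0 (singles_excess n h))\<^sup>2"
  define \<Phi> where "\<Phi> = (\<lambda>(A, c::nat). of_bool (u A < MMS n m u / 24) :: real)"
  have e: "0 < e" "e \<le> 1" using skip_prob_bounds[OF n] by (auto simp: e_def)
  have en: "0 < e * n" using e n by simp
  have st: "0 \<le> s" "0 \<le> t" by (auto simp: s_def t_def)
  have big: "1 \<le> (d / (e * n))\<^sup>2 * (max 0 y)\<^sup>2" if "e * n / d \<le> y" "0 < d" for d y
  proof -
    have "0 < e * n / d" using en that by simp
    then have "0 < y" using that(1) by linarith
    then have "1 \<le> d / (e * n) * max 0 y" using that en by (simp add: field_simps)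
    then show ?thesis unfolding power_mult_distrib[symmetric] by (rule one_le_power)
  qed
  have "measure_pmf.expectation (serve n m h u) \<Phi> \<le> s + t"
  proof (cases "(\<exists>g. valuable n m h u g) \<or> may_sample n m h u")
    case True
    have "measure_pmf.expectation (serve n m h u) \<Phi> \<le> measure_pmf.expectation (serve n m h u) (\<lambda>_. 0)"
      using serve_success[OF u True] h
      by (intro expectation_mono_finite finite_serve) (fastforce simp: \<Phi>_def)
    then show ?thesis using st by simp
  next
    case False
    have "measure_pmf.expectation (serve n m h u) \<Phi> \<le> measure_pmf.expectation (serve n m h u) (\<lambda>_. 1)"
      by (intro expectation_mono_finite finite_serve) (auto simp: \<Phi>_def)
    moreover have "1 \<le> s + t"
    proof (cases "e * n / 2 \<le> real n - real (singles h)")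
      case True
      then have "V (remaining m h) < N / 24 + (real n - real (singles h)) / 3"
        using False enough by (force simp: e_def)
      then have "(real n - real (singles h)) / 24 \<le> deficit h"
        using h by (intro deficit_ge) auto
      then have "e * n / 48 \<le> deficit h" using True by simp
      from big[OF this] show ?thesis using st by (simp add: s_def)
    next
      case False
      \<comment> \<open>More than \<open>n - e * n / 2\<close> singles among at most
        \<open>n\<close> agents exceed \<open>(1 - e) * n\<close> by at least
        \<open>e * n / 2\<close>.\<close>
      have "(1 - e) * real (length h) \<le> (1 - e) * n" using e h by (intro mult_left_mono) auto
      then have "e * n / 2 \<le> singles_excess n h"
        using False by (simp add: singles_excess_def e_def algebra_simps)
      from big[OF this] show ?thesis using st by (simp add: t_def)
    qed
    ultimately show ?thesis by simp
  qed
  then have "(1 - e) * measure_pmf.expectation (serve n m h u) \<Phi> \<le> (1 - e) * (s + t)"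
    using e by (intro mult_left_mono) auto
  also have "\<dots> \<le> s + t" using st e by (simp add: algebra_simps)
  moreover have "e * \<Phi> ({}, 0) \<le> e" using e by (simp add: \<Phi>_def)
  ultimately show ?thesis
    unfolding expectation_single_or_sample[OF n] \<Phi>_def[symmetric] e_def[symmetric] s_def[symmetric]
      t_def[symmetric] by linarith
qed

text \<open>The constants are \<open>48\<^sup>2 * 2\<close> and \<open>2\<^sup>2\<close>: squared
  Chebyshev factors times the second moment growth per arrival, summed over at most \<open>n\<close>
  arrivals.\<close>

definition failure_bound :: "nat \<Rightarrow> real" where
  "failure_bound n = skip_prob n + 4608 / (skip_prob n ^ 4 * n) + 4 / (skip_prob n ^ 2 * n)"

lemma failure_bound_tendsto: "failure_bound \<longlonglongrightarrow> 0"
  unfolding failure_bound_def[abs_def] skip_prob_def by real_asymp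

text \<open>The conditional failure bound for agent \<open>i\<close> is averaged over the
  transcripts of the \<open>i - 1\<close> earlier arrivals, with both second moments bounded by
  accumulated drift.\<close>

lemma run_failure_le:
  assumes inst: "submodular_instance n m v" and i: "i \<in> {1..n}"
  shows "measure_pmf.expectation (run single_or_sample n m v n)
      (\<lambda>h. of_bool (v i (bundle_of h i) < MMS n m (v i) / 24)) \<le> failure_bound n"
proof -
  define F where "F h = (of_bool (v i (bundle_of h i) < MMS n m (v i) / 24) :: real)" for h
  have n: "1 \<le> n" and j: "i - 1 < n" "Suc (i - 1) = i" using i by auto
  have v: "\<And>S. S \<subseteq> {1..m} \<Longrightarrow> 0 \<le> v k S" "mono_on (Pow {1..m}) (v k)"
    "submodular_on {1..m} (v k)" if "k \<in> {1..n}" for k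
    using inst that unfolding submodular_instance_def by blast+
  have e: "0 < skip_prob n" using skip_prob_bounds[OF n] by auto
  let ?run = "run single_or_sample n m v (i - 1)"
  have "measure_pmf.expectation (run single_or_sample n m v n) F
      = measure_pmf.expectation (run single_or_sample n m v i) F"
    using i by (intro expectation_run_stable) (auto simp: F_def bundle_of_def nth_append)
  also have "\<dots> = measure_pmf.expectation ?run (\<lambda>h.
      measure_pmf.expectation (single_or_sample n m h (v i)) (\<lambda>(A, c). F (h @ [(v i, A, c)])))"
    using expectation_run_Suc[of n m v "i - 1" F] unfolding j(2) .
  also have "\<dots> = measure_pmf.expectation ?run (\<lambda>h. measure_pmf.expectation (single_or_sample n m h (v i))
      (\<lambda>(A, c). of_bool (v i A < MMS n m (v i) / 24)))"
    by (intro integral_cong_AE)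
      (auto simp: AE_measure_pmf_iff F_def bundle_of_def nth_append dest!: set_run)
  also have "\<dots> \<le> failure_bound n"
  proof (cases "0 < MMS n m (v i)")
    case True
    \<comment> \<open>\<open>V\<close> comes from the valuation of agent \<open>i\<close>, which
      earlier agents do not see. It serves only the analysis and is fixed during the run because the
      instance is.\<close>
    obtain N V where "goods_supply n m N V"
      and enough: "\<And>h. \<nexists>g. valuable n m h (v i) g \<Longrightarrow> skip_prob n * n / 2 \<le> real n - real (singles h) \<Longrightarrow>
           N / 24 + (real n - real (singles h)) / 3 \<le> V (remaining m h) \<Longrightarrow> may_sample n m h (v i)"
      using goods_supply_exists[OF n v[OF i] True] by blast
    then interpret goods_supply n m N V by simp
    define c1 c2 where "c1 = (48 / (skip_prob n * n))\<^sup>2" and "c2 = (2 / (skip_prob n * n))\<^sup>2"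
    define D X where "D h = (max 0 (deficit h))\<^sup>2" and "X h = (max 0 (singles_excess n h))\<^sup>2" for h
    have "measure_pmf.expectation ?run D \<le> D [] + real (i - 1) * (2 / (skip_prob n)\<^sup>2)"
      unfolding D_def using j(1)
      by (intro expectation_run_le[where n = n] deficit_step n v) auto
    also have "\<dots> \<le> n * (2 / (skip_prob n)\<^sup>2)"
      unfolding D_def using j by (simp add: divide_right_mono)
    finally have D: "measure_pmf.expectation ?run D \<le> n * (2 / (skip_prob n)\<^sup>2)" .
    have "measure_pmf.expectation ?run X \<le> X [] + real (i - 1) * 1"
      unfolding X_def using j(1) by (intro expectation_run_le[where n = n] singles_excess_step n) auto
    also have "\<dots> \<le> n" unfolding X_def singles_excess_def using j by simp
    finally have X: "measure_pmf.expectation ?run X \<le> n" .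
    have "measure_pmf.expectation ?run (\<lambda>h. measure_pmf.expectation (single_or_sample n m h (v i))
          (\<lambda>(A, c). of_bool (v i A < MMS n m (v i) / 24)))
        \<le> measure_pmf.expectation ?run (\<lambda>h. skip_prob n + c1 * D h + c2 * X h)"
      unfolding c1_def c2_def D_def X_def using set_run[of _ n m v "i - 1"] j v[OF i]
      by (intro expectation_mono_finite finite_run failure_le n enough) auto
    also have "\<dots> = skip_prob n + c1 * measure_pmf.expectation ?run D + c2 * measure_pmf.expectation ?run X"
      by (simp add: integrable_measure_pmf_finite finite_run)
    also have "\<dots> \<le> skip_prob n + c1 * (n * (2 / (skip_prob n)\<^sup>2)) + c2 * n"
      using D X by (intro add_mono mult_left_mono) (auto simp: c1_def c2_def)
    also have "\<dots> = failure_bound n"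
      using e n by (simp add: failure_bound_def c1_def c2_def field_simps eval_nat_numeral)
    finally show ?thesis .
  next
    case False
    \<comment> \<open>With a nonpositive share, any bundle suffices because values are
      nonnegative.\<close>
    have "measure_pmf.expectation ?run (\<lambda>h. measure_pmf.expectation (single_or_sample n m h (v i))
          (\<lambda>(A, c). of_bool (v i A < MMS n m (v i) / 24)))
        \<le> measure_pmf.expectation ?run (\<lambda>h. measure_pmf.expectation (single_or_sample n m h (v i)) (\<lambda>_. 0 :: real))"
    proof (intro expectation_mono_finite finite_run finite_single_or_sample)
      fix h x assume "x \<in> set_pmf (single_or_sample n m h (v i))"
      then have "0 \<le> v i (fst x)"
        using set_single_or_sample[of "fst x" "snd x" n m h "v i"] remaining_subset[of m h]
        by (intro v(1)[OF i]) auto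
      then show "(case x of (A, c) \<Rightarrow> of_bool (v i A < MMS n m (v i) / 24)) \<le> (0::real)"
        using False by (auto simp: case_prod_unfold)
    qed
    also have "\<dots> \<le> failure_bound n" using e by (simp add: failure_bound_def)
    finally show ?thesis .
  qed
  finally show ?thesis unfolding F_def .
qed

theorem corollary6p2:
  "\<exists>(alg :: randomized_algorithm) (\<epsilon> :: nat \<Rightarrow> real).
     online_algorithm alg \<and> \<epsilon> \<longlonglongrightarrow> 0 \<and>
     (\<forall>(n::nat) (m::nat) (v :: nat \<Rightarrow> valuation). submodular_instance n m v \<longrightarrow>
        (\<forall>i\<in>{1..n}.
           measure_pmf.prob (run alg n m v n)
             {h. v i (bundle_of h i) \<ge> 1 / 24 * MMS n m (v i)} \<ge> 1 - \<epsilon> n))"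
proof (intro exI conjI allI impI ballI)
  show "online_algorithm single_or_sample" by (rule online_single_or_sample)
  show "failure_bound \<longlonglongrightarrow> 0" by (rule failure_bound_tendsto)
  fix n m v i assume inst: "submodular_instance n m v" and i: "i \<in> {1..n}"
  let ?run = "run single_or_sample n m v n"
  let ?S = "{h. v i (bundle_of h i) \<ge> 1 / 24 * MMS n m (v i)}"
  have "measure_pmf.prob ?run (- ?S) = measure_pmf.expectation ?run (indicator (- ?S))"
    by simp
  also have "(indicator (- ?S) :: _ \<Rightarrow> real) = (\<lambda>h. of_bool (v i (bundle_of h i) < MMS n m (v i) / 24))"
    by (auto simp: indicator_def)
  finally have "measure_pmf.prob ?run (- ?S) \<le> failure_bound n"
    using run_failure_le[OF inst i] by simp
  then show "1 - failure_bound n \<le> measure_pmf.prob ?run ?S"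
    using measure_pmf.prob_compl[of ?S ?run] by (simp add: Compl_eq_Diff_UNIV)
qed

end
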